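(* Let $T$ be a KAN-algebra. Then $\langle M(T),\cup,\cap,\approx,\circledast,c_M,0_M,1_M\rangle$ is a centered KAN-algebra (with $\cup$ as join, $\cap$ as meet, $\approx$ in the role of $\sim$, $\circledast$ in the role of $\neg$, and center $c_M$).
   Context: A Kleene algebra is an algebra $\langle T,\vee,\wedge,\sim,0,1\rangle$ whose reduct $\langle T,\vee,\wedge,0,1\rangle$ is a bounded distributive lattice and such that $\sim\sim x=x$, $\sim(x\vee y)=\sim x\wedge\sim y$ and $x\wedge\sim x\le y\vee\sim y$ for all $x,y$. A KAN-algebra is an algebra $\langle T,\vee,\wedge,\sim,\neg,0,1\rangle$ of type $(2,2,1,1,0,0)$ whose $\neg$-free reduct is a Kleene algebra and which satisfies: (N1) $\neg(x\wedge\neg(x\wedge y))=\neg(x\wedge\neg y)$; (N2) $\neg(x\vee y)=\neg x\wedge\neg y$; (N3) $x\wedge\sim x=x\wedge\neg x$; (N4) $\sim x\le\neg x$; (N5) $\neg(x\wedge y)=\neg((\sim\neg x)\wedge y)$. A centered KAN-algebra is an algebra $\langle T,\vee,\wedge,\sim,\neg,c,0,1\rangle$ where $\langle T,\vee,\wedge,\sim,\neg,0,1\rangle$ is a KAN-algebra and the constant $c$ (the center) satisfies $\sim c=c$. Notation: $\lozenge x:=\sim\neg x$, $\square x:=\neg\sim x$, $T^{\lozenge}:=\{x\in T:\lozenge x=x\}$, $T^{\square}:=\{x\in T:\square x=x\}$. For a KAN-algebra $T$, $M(T):=\{(x,y)\in T^{\lozenge}\times T^{\square}: x\le y\}$, with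 the operations (under which $M(T)$ is closed) $(a,b)\cup(d,e):=(a\vee d,\square(b\vee e))$, $(a,b)\cap(d,e):=(\lozenge(a\wedge d),b\wedge e)$, $\approx(a,b):=(\sim b,\sim a)$, $\circledast(a,b):=(\lozenge\neg a,\sim a)$, $0_M:=(0,0)$, $1_M:=(1,1)$, $c_M:=(0,1)$. *)

theory Defs
  imports "HOL-Algebra.Congruence"
begin

text \<open>The library's bounded distributive lattices are either type classes (whole types) or
  partial orders in which join and meet are derived notions. Here the universe has to be a carrier
  set and the operations are part of the signature, so the algebras are records with a carrier.\<close>

record 'a kleene_algebra_sig = "'a partial_object" +
  join :: "'a \<Rightarrow> 'a \<Rightarrow> 'a" (infixl \<open>\<squnion>\<index>\<close> 65)
  meet :: "'a \<Rightarrow> 'a \<Rightarrow> 'a" (infixl \<open>\<sqinter>\<index>\<close> 70)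
  sim :: "'a \<Rightarrow> 'a" (\<open>\<sim>\<index> _\<close> [81] 80)
  bot_elem :: 'a (\<open>\<bottom>\<index>\<close>)
  top_elem :: 'a (\<open>\<top>\<index>\<close>)

record 'a KAN_algebra_sig = "'a kleene_algebra_sig" +
  neg :: "'a \<Rightarrow> 'a" (\<open>\<ominus>\<index> _\<close> [81] 80)

record 'a centered_KAN_algebra_sig = "'a KAN_algebra_sig" +
  center :: 'a (\<open>\<c>\<index>\<close>)

definition lat_le :: "('a, 'b) kleene_algebra_sig_scheme \<Rightarrow> 'a \<Rightarrow> 'a \<Rightarrow> bool"
    (infix \<open>\<sqsubseteq>\<index>\<close> 50) where
  "x \<sqsubseteq>\<^bsub>T\<^esub> y \<longleftrightarrow> x \<sqinter>\<^bsub>T\<^esub> y = x"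

locale bounded_distributive_lattice =
  fixes T :: "('a, 'b) kleene_algebra_sig_scheme" (structure)
  assumes join_closed: "\<lbrakk>x \<in> carrier T; y \<in> carrier T\<rbrakk> \<Longrightarrow> x \<squnion> y \<in> carrier T"
    and meet_closed: "\<lbrakk>x \<in> carrier T; y \<in> carrier T\<rbrakk> \<Longrightarrow> x \<sqinter> y \<in> carrier T"
    and bot_closed: "\<bottom> \<in> carrier T"
    and top_closed: "\<top> \<in> carrier T"
    and join_assoc: "\<lbrakk>x \<in> carrier T; y \<in> carrier T; z \<in> carrier T\<rbrakk> \<Longrightarrow>
      (x \<squnion> y) \<squnion> z = x \<squnion> (y \<squnion> z)"
    and meet_assoc: "\<lbrakk>x \<in> carrier T; y \<in> carrier T; z \<in> carrier T\<rbrakk> \<Longrightarrow>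
      (x \<sqinter> y) \<sqinter> z = x \<sqinter> (y \<sqinter> z)"
    and join_comm: "\<lbrakk>x \<in> carrier T; y \<in> carrier T\<rbrakk> \<Longrightarrow> x \<squnion> y = y \<squnion> x"
    and meet_comm: "\<lbrakk>x \<in> carrier T; y \<in> carrier T\<rbrakk> \<Longrightarrow> x \<sqinter> y = y \<sqinter> x"
    and join_absorb: "\<lbrakk>x \<in> carrier T; y \<in> carrier T\<rbrakk> \<Longrightarrow> x \<squnion> (x \<sqinter> y) = x"
    and meet_absorb: "\<lbrakk>x \<in> carrier T; y \<in> carrier T\<rbrakk> \<Longrightarrow> x \<sqinter> (x \<squnion> y) = x"
    and meet_join_distrib: "\<lbrakk>x \<in> carrier T; y \<in> carrier T; z \<in> carrier T\<rbrakk> \<Longrightarrow>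
      x \<sqinter> (y \<squnion> z) = (x \<sqinter> y) \<squnion> (x \<sqinter> z)"
    and bot_least: "x \<in> carrier T \<Longrightarrow> \<bottom> \<sqsubseteq> x"
    and top_greatest: "x \<in> carrier T \<Longrightarrow> x \<sqsubseteq> \<top>"

locale kleene_algebra = bounded_distributive_lattice +
  assumes sim_closed: "x \<in> carrier T \<Longrightarrow> \<sim> x \<in> carrier T"
    and sim_sim: "x \<in> carrier T \<Longrightarrow> \<sim> (\<sim> x) = x"
    and sim_join: "\<lbrakk>x \<in> carrier T; y \<in> carrier T\<rbrakk> \<Longrightarrow> \<sim> (x \<squnion> y) = (\<sim> x) \<sqinter> (\<sim> y)"
    and kleene: "\<lbrakk>x \<in> carrier T; y \<in> carrier T\<rbrakk> \<Longrightarrow> x \<sqinter> (\<sim> x) \<sqsubseteq> y \<squnion> (\<sim> y)"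

locale KAN_algebra = kleene_algebra T
  for T :: "('a, 'b) KAN_algebra_sig_scheme" (structure) +
  assumes neg_closed: "x \<in> carrier T \<Longrightarrow> \<ominus> x \<in> carrier T"
    and N1: "\<lbrakk>x \<in> carrier T; y \<in> carrier T\<rbrakk> \<Longrightarrow>
      \<ominus> (x \<sqinter> (\<ominus> (x \<sqinter> y))) = \<ominus> (x \<sqinter> (\<ominus> y))"
    and N2: "\<lbrakk>x \<in> carrier T; y \<in> carrier T\<rbrakk> \<Longrightarrow> \<ominus> (x \<squnion> y) = (\<ominus> x) \<sqinter> (\<ominus> y)"
    and N3: "x \<in> carrier T \<Longrightarrow> x \<sqinter> (\<sim> x) = x \<sqinter> (\<ominus> x)"
    and N4: "x \<in> carrier T \<Longrightarrow> (\<sim> x) \<sqsubseteq> (\<ominus> x)"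
    and N5: "\<lbrakk>x \<in> carrier T; y \<in> carrier T\<rbrakk> \<Longrightarrow>
      \<ominus> (x \<sqinter> y) = \<ominus> ((\<sim> (\<ominus> x)) \<sqinter> y)"

locale centered_KAN_algebra = KAN_algebra T
  for T :: "('a, 'b) centered_KAN_algebra_sig_scheme" (structure) +
  assumes center_closed: "\<c> \<in> carrier T"
    and sim_center: "\<sim> \<c> = \<c>"

definition lozenge :: "('a, 'b) KAN_algebra_sig_scheme \<Rightarrow> 'a \<Rightarrow> 'a" (\<open>\<diamond>\<index> _\<close> [81] 80) where
  "\<diamond>\<^bsub>T\<^esub> x = \<sim>\<^bsub>T\<^esub> (\<ominus>\<^bsub>T\<^esub> x)"

definition square :: "('a, 'b) KAN_algebra_sig_scheme \<Rightarrow> 'a \<Rightarrow> 'a" (\<open>\<box>\<index> _\<close> [81] 80) where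
  "\<box>\<^bsub>T\<^esub> x = \<ominus>\<^bsub>T\<^esub> (\<sim>\<^bsub>T\<^esub> x)"

definition lozenge_fixed :: "('a, 'b) KAN_algebra_sig_scheme \<Rightarrow> 'a set" where
  "lozenge_fixed T = {x \<in> carrier T. \<diamond>\<^bsub>T\<^esub> x = x}"

definition square_fixed :: "('a, 'b) KAN_algebra_sig_scheme \<Rightarrow> 'a set" where
  "square_fixed T = {x \<in> carrier T. \<box>\<^bsub>T\<^esub> x = x}"

definition M_algebra ::
    "('a, 'b) KAN_algebra_sig_scheme \<Rightarrow> ('a \<times> 'a) centered_KAN_algebra_sig" where
  "M_algebra T = \<lparr>
     carrier = {(x, y). x \<in> lozenge_fixed T \<and> y \<in> square_fixed T \<and> x \<sqsubseteq>\<^bsub>T\<^esub> y},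
     join = (\<lambda>(a, b) (d, e). (a \<squnion>\<^bsub>T\<^esub> d, \<box>\<^bsub>T\<^esub> (b \<squnion>\<^bsub>T\<^esub> e))),
     meet = (\<lambda>(a, b) (d, e). (\<diamond>\<^bsub>T\<^esub> (a \<sqinter>\<^bsub>T\<^esub> d), b \<sqinter>\<^bsub>T\<^esub> e)),
     sim = (\<lambda>(a, b). (\<sim>\<^bsub>T\<^esub> b, \<sim>\<^bsub>T\<^esub> a)),
     bot_elem = (\<bottom>\<^bsub>T\<^esub>, \<bottom>\<^bsub>T\<^esub>),
     top_elem = (\<top>\<^bsub>T\<^esub>, \<top>\<^bsub>T\<^esub>),
     neg = (\<lambda>(a, b). (\<diamond>\<^bsub>T\<^esub> (\<ominus>\<^bsub>T\<^esub> a), \<sim>\<^bsub>T\<^esub> a)),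
     center = (\<bottom>\<^bsub>T\<^esub>, \<top>\<^bsub>T\<^esub>)\<rparr>"

end

theory Submission
  imports Defs
begin

text \<open>The idea is that \<open>M(T)\<close> is glued from two bounded distributive lattices which are quotients
  of \<open>T\<close>. By N2, N4 and N5 the map \<open>\<diamond>\<close> is an interior operator that preserves joins and satisfies
  \<open>\<diamond>(x \<sqinter> \<diamond>y) = \<diamond>(x \<sqinter> y)\<close>; so it is a lattice homomorphism from \<open>T\<close> onto its set of fixed points,
  when that set carries the join of \<open>T\<close> and the meet \<open>\<diamond>(a \<sqinter> d)\<close>. Since \<open>\<box>x = \<sim>\<diamond>\<sim>x\<close>, the map \<open>\<box>\<close> is
  the De Morgan dual: a closure operator and a homomorphism onto its fixed points with the join
  \<open>\<box>(b \<squnion> e)\<close> and the meet of \<open>T\<close>. The lattice operations of \<open>M(T)\<close> are componentwise in these two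
  lattices, hence they satisfy the laws of bounded distributive lattices. The map \<open>\<sim>\<close> is a dual
  isomorphism between the two, which makes \<open>(a, b) \<mapsto> (\<sim>b, \<sim>a)\<close> a De Morgan involution.

  The remaining laws rest on two facts. The first is that \<open>\<diamond>(a \<sqinter> \<sim>a) = \<bottom>\<close>, which follows from N1 and
  N3 (lemma \<open>lozenge_meet_sim\<close>). So for \<open>a \<sqsubseteq> b\<close> the meet of \<open>(a, b)\<close> and \<open>(\<sim>b, \<sim>a)\<close> has first
  component \<open>\<bottom>\<close>, dually their join has second component \<open>\<top>\<close>, and the Kleene inequality is immediate.
  The second is that \<open>\<ominus>a = \<sim>a\<close> whenever \<open>\<diamond>a = a\<close> (lemma \<open>neg_lozenge_fixed\<close>). So the new negation
  sends \<open>(a, b)\<close> to \<open>(\<diamond>\<sim>a, \<sim>a)\<close> and depends on \<open>a\<close> alone, which reduces N1-N5 to short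
  computations in \<open>T\<close>. The involution fixes \<open>(\<bottom>, \<top>)\<close> because \<open>\<sim>\<close> exchanges the bounds of
  \<open>T\<close>.\<close>

section \<open>Order and De Morgan laws\<close>

context bounded_distributive_lattice
begin

lemma join_idem: "x \<in> carrier T \<Longrightarrow> x \<squnion> x = x"
  by (metis join_absorb meet_absorb join_closed)

lemma meet_idem: "x \<in> carrier T \<Longrightarrow> x \<sqinter> x = x"
  by (metis join_absorb meet_absorb meet_closed)

lemma lat_le_iff_join:
  assumes "x \<in> carrier T" "y \<in> carrier T"
  shows "x \<sqsubseteq> y \<longleftrightarrow> x \<squnion> y = y"
  using assms unfolding lat_le_def by (metis join_absorb meet_absorb join_comm meet_comm)

lemma lat_le_trans:
  assumes "x \<in> carrier T" "y \<in> carrier T" "z \<in> carrier T" "x \<sqsubseteq> y" "y \<sqsubseteq> z"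
  shows "x \<sqsubseteq> z"
  using assms unfolding lat_le_def by (metis meet_assoc)

lemma meet_left_mono:
  assumes "x \<in> carrier T" "y \<in> carrier T" "z \<in> carrier T" "y \<sqsubseteq> z"
  shows "x \<sqinter> y \<sqsubseteq> x \<sqinter> z"
  using assms unfolding lat_le_def by (metis meet_assoc meet_comm meet_closed meet_idem)

lemma meet_mono:
  assumes "w \<in> carrier T" "x \<in> carrier T" "y \<in> carrier T" "z \<in> carrier T" "w \<sqsubseteq> x" "y \<sqsubseteq> z"
  shows "w \<sqinter> y \<sqsubseteq> x \<sqinter> z"
proof (rule lat_le_trans)
  show "w \<sqinter> y \<sqsubseteq> w \<sqinter> z"
    using assms by (intro meet_left_mono)
  show "w \<sqinter> z \<sqsubseteq> x \<sqinter> z"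
    using assms meet_left_mono[of z w x] by (simp add: meet_comm)
qed (use assms in \<open>simp_all add: meet_closed\<close>)

lemma join_left_mono:
  assumes "x \<in> carrier T" "y \<in> carrier T" "z \<in> carrier T" "y \<sqsubseteq> z"
  shows "x \<squnion> y \<sqsubseteq> x \<squnion> z"
proof -
  have "(x \<squnion> y) \<squnion> (x \<squnion> z) = ((x \<squnion> x) \<squnion> y) \<squnion> z"
    using assms by (metis join_assoc join_comm join_closed)
  also have "\<dots> = x \<squnion> z"
    using assms by (simp add: join_idem join_assoc lat_le_iff_join join_closed)
  finally show ?thesis
    using assms by (simp add: lat_le_iff_join join_closed)
qed

lemma join_mono:
  assumes "w \<in> carrier T" "x \<in> carrier T" "y \<in> carrier T" "z \<in> carrier T" "w \<sqsubseteq> x" "y \<sqsubseteq> z"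
  shows "w \<squnion> y \<sqsubseteq> x \<squnion> z"
proof (rule lat_le_trans)
  show "w \<squnion> y \<sqsubseteq> w \<squnion> z"
    using assms by (intro join_left_mono)
  show "w \<squnion> z \<sqsubseteq> x \<squnion> z"
    using assms join_left_mono[of z w x] by (simp add: join_comm)
qed (use assms in \<open>simp_all add: join_closed\<close>)

lemma meet_bot: "x \<in> carrier T \<Longrightarrow> x \<sqinter> \<bottom> = \<bottom>"
  by (metis bot_least lat_le_def meet_comm bot_closed)

lemma bot_meet: "x \<in> carrier T \<Longrightarrow> \<bottom> \<sqinter> x = \<bottom>"
  using bot_least lat_le_def by metis

lemma meet_top: "x \<in> carrier T \<Longrightarrow> x \<sqinter> \<top> = x"
  using top_greatest lat_le_def by metis

lemma le_bot: "\<lbrakk>x \<in> carrier T; x \<sqsubseteq> \<bottom>\<rbrakk> \<Longrightarrow> x = \<bottom>"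
  by (metis meet_bot lat_le_def)

end

context kleene_algebra
begin

lemma sim_meet:
  assumes "x \<in> carrier T" "y \<in> carrier T"
  shows "\<sim> (x \<sqinter> y) = (\<sim> x) \<squnion> (\<sim> y)"
  using assms by (metis sim_closed sim_join sim_sim join_closed)

lemma sim_antimono:
  assumes "x \<in> carrier T" "y \<in> carrier T" "x \<sqsubseteq> y"
  shows "\<sim> y \<sqsubseteq> \<sim> x"
  using assms by (metis lat_le_def lat_le_iff_join sim_join sim_closed meet_comm)

lemma sim_top: "\<sim> \<top> = \<bottom>"
proof (rule le_bot)
  have "\<sim> \<top> \<sqsubseteq> \<sim> (\<sim> \<bottom>)"
    by (intro sim_antimono top_greatest sim_closed bot_closed top_closed)
  thus "\<sim> \<top> \<sqsubseteq> \<bottom>" by (simp add: sim_sim bot_closed)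
qed (simp add: sim_closed top_closed)

lemma sim_bot: "\<sim> \<bottom> = \<top>"
  by (metis sim_top sim_sim top_closed)

end

section \<open>The operators \<open>\<diamond>\<close> and \<open>\<box>\<close>\<close>

context KAN_algebra
begin

lemma lozenge_closed: "x \<in> carrier T \<Longrightarrow> \<diamond> x \<in> carrier T"
  by (simp add: lozenge_def sim_closed neg_closed)

lemma square_closed: "x \<in> carrier T \<Longrightarrow> \<box> x \<in> carrier T"
  by (simp add: square_def sim_closed neg_closed)

lemmas closed = join_closed meet_closed bot_closed top_closed sim_closed neg_closed
  lozenge_closed square_closed

lemma neg_top: "\<ominus> \<top> = \<bottom>"
  using N3[of \<top>] by (metis sim_top meet_comm meet_top closed(3,4,6) meet_bot)

lemma neg_bot: "\<ominus> \<bottom> = \<top>"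
  using N4[of \<bottom>] by (metis sim_bot lat_le_def meet_comm meet_top closed(3,4,6))

lemma sim_lozenge: "x \<in> carrier T \<Longrightarrow> \<sim> (\<diamond> x) = \<ominus> x"
  by (simp add: lozenge_def sim_sim neg_closed)

lemma square_eq: "x \<in> carrier T \<Longrightarrow> \<box> x = \<sim> (\<diamond> (\<sim> x))"
  by (simp add: square_def sim_lozenge sim_closed)

lemma sim_square: "x \<in> carrier T \<Longrightarrow> \<sim> (\<box> x) = \<diamond> (\<sim> x)"
  by (simp add: square_eq sim_sim closed)

lemma lozenge_le: "x \<in> carrier T \<Longrightarrow> \<diamond> x \<sqsubseteq> x"
  using sim_antimono[OF _ _ N4, of x] by (simp add: lozenge_def sim_sim closed)

lemma lozenge_join:
  "\<lbrakk>x \<in> carrier T; y \<in> carrier T\<rbrakk> \<Longrightarrow> \<diamond> (x \<squnion> y) = \<diamond> x \<squnion> \<diamond> y"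
  by (simp add: lozenge_def N2 sim_meet closed)

text \<open>This is N5, and it says that the kernel of \<open>\<diamond>\<close> is compatible with meets.\<close>

lemma lozenge_meet_left:
  "\<lbrakk>x \<in> carrier T; y \<in> carrier T\<rbrakk> \<Longrightarrow> \<diamond> (\<diamond> x \<sqinter> y) = \<diamond> (x \<sqinter> y)"
  unfolding lozenge_def by (metis N5)

lemma lozenge_meet_right:
  "\<lbrakk>x \<in> carrier T; y \<in> carrier T\<rbrakk> \<Longrightarrow> \<diamond> (x \<sqinter> \<diamond> y) = \<diamond> (x \<sqinter> y)"
  by (metis lozenge_meet_left meet_comm lozenge_closed)

lemma lozenge_lozenge: "x \<in> carrier T \<Longrightarrow> \<diamond> (\<diamond> x) = \<diamond> x"
  using lozenge_meet_left[of x \<top>] by (simp add: meet_top closed)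

lemma lozenge_bot: "\<diamond> \<bottom> = \<bottom>"
  by (simp add: lozenge_def neg_bot sim_top)

lemma lozenge_top: "\<diamond> \<top> = \<top>"
  by (simp add: lozenge_def neg_top sim_bot)

lemma lozenge_mono:
  assumes "x \<in> carrier T" "y \<in> carrier T" "x \<sqsubseteq> y"
  shows "\<diamond> x \<sqsubseteq> \<diamond> y"
  using assms by (metis lat_le_iff_join lozenge_join lozenge_closed)

lemma le_square: "x \<in> carrier T \<Longrightarrow> x \<sqsubseteq> \<box> x"
  using sim_antimono[OF _ _ lozenge_le, of "\<sim> x"] by (simp add: square_eq sim_sim closed)

lemma square_meet:
  "\<lbrakk>x \<in> carrier T; y \<in> carrier T\<rbrakk> \<Longrightarrow> \<box> (x \<sqinter> y) = \<box> x \<sqinter> \<box> y"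
  by (simp add: square_eq sim_meet lozenge_join sim_join closed)

lemma square_join_left:
  "\<lbrakk>x \<in> carrier T; y \<in> carrier T\<rbrakk> \<Longrightarrow> \<box> (\<box> x \<squnion> y) = \<box> (x \<squnion> y)"
  by (simp add: square_eq sim_join sim_sim lozenge_meet_left closed)

lemma square_join_right:
  "\<lbrakk>x \<in> carrier T; y \<in> carrier T\<rbrakk> \<Longrightarrow> \<box> (x \<squnion> \<box> y) = \<box> (x \<squnion> y)"
  by (simp add: square_eq sim_join sim_sim lozenge_meet_right closed)

lemma square_square: "x \<in> carrier T \<Longrightarrow> \<box> (\<box> x) = \<box> x"
  by (simp add: square_eq sim_sim lozenge_lozenge closed)

lemma square_bot: "\<box> \<bottom> = \<bottom>"
  by (simp add: square_def sim_bot neg_top)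

lemma square_top: "\<box> \<top> = \<top>"
  by (simp add: square_def sim_top neg_bot)

lemma neg_lozenge_fixed: "\<lbrakk>x \<in> carrier T; \<diamond> x = x\<rbrakk> \<Longrightarrow> \<ominus> x = \<sim> x"
  using sim_lozenge[of x] by simp

text \<open>N1 with \<open>y = \<top>\<close> says \<open>\<ominus> (x \<sqinter> \<ominus> x) = \<ominus> \<bottom>\<close>, and N3 turns the inner \<open>\<ominus>\<close> into \<open>\<sim>\<close>.\<close>

lemma lozenge_meet_sim:
  assumes "x \<in> carrier T"
  shows "\<diamond> (x \<sqinter> \<sim> x) = \<bottom>"
proof -
  have "\<ominus> (x \<sqinter> \<ominus> x) = \<ominus> (x \<sqinter> \<ominus> \<top>)"
    using N1[of x \<top>] assms by (simp add: meet_top closed)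
  also have "\<dots> = \<top>"
    using assms by (simp add: neg_top meet_bot neg_bot)
  finally show ?thesis
    by (simp add: lozenge_def N3 assms sim_top)
qed

lemma lozenge_meet_sim_le:
  assumes "a \<in> carrier T" "b \<in> carrier T" "a \<sqsubseteq> b"
  shows "\<diamond> (a \<sqinter> \<sim> b) = \<bottom>"
proof (rule le_bot)
  have "\<diamond> (a \<sqinter> \<sim> b) \<sqsubseteq> \<diamond> (a \<sqinter> \<sim> a)"
    using assms by (intro lozenge_mono meet_left_mono sim_antimono closed)
  thus "\<diamond> (a \<sqinter> \<sim> b) \<sqsubseteq> \<bottom>"
    using assms by (simp add: lozenge_meet_sim)
qed (use assms in \<open>simp add: closed\<close>)

lemma square_join_sim_le:
  assumes "a \<in> carrier T" "b \<in> carrier T" "a \<sqsubseteq> b"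
  shows "\<box> (b \<squnion> \<sim> a) = \<top>"
proof -
  have "\<box> (b \<squnion> \<sim> a) = \<sim> (\<diamond> (a \<sqinter> \<sim> b))"
    using assms by (simp add: square_eq sim_join sim_sim meet_comm closed)
  thus ?thesis
    using assms by (simp add: lozenge_meet_sim_le sim_bot)
qed

section \<open>The lattice laws of \<open>M(T)\<close>\<close>

lemma M_carrier_iff:
  "(a, b) \<in> carrier (M_algebra T) \<longleftrightarrow>
     a \<in> carrier T \<and> b \<in> carrier T \<and> \<diamond> a = a \<and> \<box> b = b \<and> a \<sqsubseteq> b"
  by (auto simp: M_algebra_def lozenge_fixed_def square_fixed_def)

lemma M_cases:
  assumes "x \<in> carrier (M_algebra T)"
  obtains a b where "x = (a, b)" "(a, b) \<in> carrier (M_algebra T)"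
    "a \<in> carrier T" "b \<in> carrier T" "\<diamond> a = a" "\<box> b = b" "a \<sqsubseteq> b"
  using assms M_carrier_iff by (cases x) auto

lemma M_join: "(a, b) \<squnion>\<^bsub>M_algebra T\<^esub> (d, e) = (a \<squnion> d, \<box> (b \<squnion> e))"
  and M_meet: "(a, b) \<sqinter>\<^bsub>M_algebra T\<^esub> (d, e) = (\<diamond> (a \<sqinter> d), b \<sqinter> e)"
  and M_sim: "\<sim>\<^bsub>M_algebra T\<^esub> (a, b) = (\<sim> b, \<sim> a)"
  and M_bot: "\<bottom>\<^bsub>M_algebra T\<^esub> = (\<bottom>, \<bottom>)"
  and M_top: "\<top>\<^bsub>M_algebra T\<^esub> = (\<top>, \<top>)"
  and M_neg: "\<ominus>\<^bsub>M_algebra T\<^esub> (a, b) = (\<diamond> (\<ominus> a), \<sim> a)"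
  and M_center: "\<c>\<^bsub>M_algebra T\<^esub> = (\<bottom>, \<top>)"
  by (simp_all add: M_algebra_def)

lemmas M_ops = M_join M_meet M_sim M_bot M_top M_neg M_center

lemma M_join_closed:
  assumes "(a, b) \<in> carrier (M_algebra T)" "(d, e) \<in> carrier (M_algebra T)"
  shows "(a \<squnion> d, \<box> (b \<squnion> e)) \<in> carrier (M_algebra T)"
proof -
  have c: "a \<in> carrier T" "b \<in> carrier T" "d \<in> carrier T" "e \<in> carrier T"
    and le: "a \<sqsubseteq> b" "d \<sqsubseteq> e" and fixed: "\<diamond> a = a" "\<diamond> d = d"
    using assms by (simp_all add: M_carrier_iff)
  have "a \<squnion> d \<sqsubseteq> b \<squnion> e"
    using c le by (intro join_mono)
  hence "a \<squnion> d \<sqsubseteq> \<box> (b \<squnion> e)"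
    by (rule lat_le_trans[rotated 3]) (use c in \<open>simp_all add: le_square closed\<close>)
  thus ?thesis
    using c fixed by (simp add: M_carrier_iff closed lozenge_join square_square)
qed

lemma M_meet_closed:
  assumes "(a, b) \<in> carrier (M_algebra T)" "(d, e) \<in> carrier (M_algebra T)"
  shows "(\<diamond> (a \<sqinter> d), b \<sqinter> e) \<in> carrier (M_algebra T)"
proof -
  have c: "a \<in> carrier T" "b \<in> carrier T" "d \<in> carrier T" "e \<in> carrier T"
    and le: "a \<sqsubseteq> b" "d \<sqsubseteq> e" and fixed: "\<box> b = b" "\<box> e = e"
    using assms by (simp_all add: M_carrier_iff)
  have "a \<sqinter> d \<sqsubseteq> b \<sqinter> e"
    using c le by (intro meet_mono)
  hence "\<diamond> (a \<sqinter> d) \<sqsubseteq> b \<sqinter> e"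
    by (rule lat_le_trans[rotated 4]) (use c in \<open>simp_all add: lozenge_le closed\<close>)
  thus ?thesis
    using c fixed by (simp add: M_carrier_iff closed square_meet lozenge_lozenge)
qed

text \<open>The two components separate: each law is the same law of \<open>T\<close> after applying \<open>\<diamond>\<close> in the first
  component and \<open>\<box>\<close> in the second, because the components are fixed by these homomorphisms.\<close>

lemma M_bounded_distributive_lattice: "bounded_distributive_lattice (M_algebra T)"
proof
  let ?M = "M_algebra T"
  show "\<bottom>\<^bsub>?M\<^esub> \<in> carrier ?M"
    by (simp add: M_ops M_carrier_iff closed lozenge_bot square_bot bot_least)
  show "\<top>\<^bsub>?M\<^esub> \<in> carrier ?M"
    by (simp add: M_ops M_carrier_iff closed lozenge_top square_top top_greatest)
  fix x assume "x \<in> carrier ?M"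
  then obtain a b where x: "x = (a, b)" "(a, b) \<in> carrier ?M"
    and ab: "a \<in> carrier T" "b \<in> carrier T" "\<diamond> a = a" "\<box> b = b" "a \<sqsubseteq> b"
    by (rule M_cases)
  show "\<bottom>\<^bsub>?M\<^esub> \<sqsubseteq>\<^bsub>?M\<^esub> x"
    using ab by (simp add: x(1) M_ops lat_le_def bot_meet lozenge_bot)
  show "x \<sqsubseteq>\<^bsub>?M\<^esub> \<top>\<^bsub>?M\<^esub>"
    using ab by (simp add: x(1) M_ops lat_le_def meet_top)
  fix y assume "y \<in> carrier ?M"
  then obtain d e where y: "y = (d, e)" "(d, e) \<in> carrier ?M"
    and de: "d \<in> carrier T" "e \<in> carrier T" "\<diamond> d = d" "\<box> e = e" "d \<sqsubseteq> e"
    by (rule M_cases)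
  show "x \<squnion>\<^bsub>?M\<^esub> y \<in> carrier ?M"
    using M_join_closed[OF x(2) y(2)] by (simp add: x(1) y(1) M_ops)
  show "x \<sqinter>\<^bsub>?M\<^esub> y \<in> carrier ?M"
    using M_meet_closed[OF x(2) y(2)] by (simp add: x(1) y(1) M_ops)
  show "x \<squnion>\<^bsub>?M\<^esub> y = y \<squnion>\<^bsub>?M\<^esub> x"
    using ab de by (simp add: x(1) y(1) M_ops join_comm)
  show "x \<sqinter>\<^bsub>?M\<^esub> y = y \<sqinter>\<^bsub>?M\<^esub> x"
    using ab de by (simp add: x(1) y(1) M_ops meet_comm)
  have "a \<squnion> \<diamond> (a \<sqinter> d) = \<diamond> (a \<squnion> (a \<sqinter> d))"
    using ab de by (simp add: lozenge_join closed)
  thus "x \<squnion>\<^bsub>?M\<^esub> (x \<sqinter>\<^bsub>?M\<^esub> y) = x"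
    using ab de by (simp add: x(1) y(1) M_ops join_absorb)
  have "b \<sqinter> \<box> (b \<squnion> e) = \<box> (b \<sqinter> (b \<squnion> e))"
    using ab de by (simp add: square_meet closed)
  thus "x \<sqinter>\<^bsub>?M\<^esub> (x \<squnion>\<^bsub>?M\<^esub> y) = x"
    using ab de by (simp add: x(1) y(1) M_ops meet_absorb)
  fix z assume "z \<in> carrier ?M"
  then obtain f g where z: "z = (f, g)" "(f, g) \<in> carrier ?M"
    and fg: "f \<in> carrier T" "g \<in> carrier T" "\<diamond> f = f" "\<box> g = g" "f \<sqsubseteq> g"
    by (rule M_cases)
  show "(x \<squnion>\<^bsub>?M\<^esub> y) \<squnion>\<^bsub>?M\<^esub> z = x \<squnion>\<^bsub>?M\<^esub> (y \<squnion>\<^bsub>?M\<^esub> z)"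
    using ab de fg
    by (simp add: x(1) y(1) z(1) M_ops join_assoc square_join_left square_join_right closed)
  show "(x \<sqinter>\<^bsub>?M\<^esub> y) \<sqinter>\<^bsub>?M\<^esub> z = x \<sqinter>\<^bsub>?M\<^esub> (y \<sqinter>\<^bsub>?M\<^esub> z)"
    using ab de fg
    by (simp add: x(1) y(1) z(1) M_ops meet_assoc lozenge_meet_left lozenge_meet_right closed)
  have "b \<sqinter> \<box> (e \<squnion> g) = \<box> (b \<sqinter> (e \<squnion> g))"
    using ab de fg by (simp add: square_meet closed)
  thus "x \<sqinter>\<^bsub>?M\<^esub> (y \<squnion>\<^bsub>?M\<^esub> z) = (x \<sqinter>\<^bsub>?M\<^esub> y) \<squnion>\<^bsub>?M\<^esub> (x \<sqinter>\<^bsub>?M\<^esub> z)"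
    using ab de fg by (simp add: x(1) y(1) z(1) M_ops meet_join_distrib lozenge_join closed)
qed

section \<open>The negations of \<open>M(T)\<close>\<close>

lemma M_kleene_algebra: "kleene_algebra (M_algebra T)"
proof (intro kleene_algebra.intro[OF M_bounded_distributive_lattice] kleene_algebra_axioms.intro)
  let ?M = "M_algebra T"
  fix x assume "x \<in> carrier ?M"
  then obtain a b where x: "x = (a, b)" "(a, b) \<in> carrier ?M"
    and ab: "a \<in> carrier T" "b \<in> carrier T" "\<diamond> a = a" "\<box> b = b" "a \<sqsubseteq> b"
    by (rule M_cases)
  have "\<diamond> (\<sim> b) = \<sim> b" "\<box> (\<sim> a) = \<sim> a"
    using ab sim_square[of b] square_eq[of "\<sim> a"] by (simp_all add: sim_sim closed)
  thus "\<sim>\<^bsub>?M\<^esub> x \<in> carrier ?M"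
    using ab by (simp add: x(1) M_ops M_carrier_iff closed sim_antimono)
  show "\<sim>\<^bsub>?M\<^esub> (\<sim>\<^bsub>?M\<^esub> x) = x"
    using ab by (simp add: x(1) M_ops sim_sim)
  fix y assume "y \<in> carrier ?M"
  then obtain d e where y: "y = (d, e)" "(d, e) \<in> carrier ?M"
    and de: "d \<in> carrier T" "e \<in> carrier T" "\<diamond> d = d" "\<box> e = e" "d \<sqsubseteq> e"
    by (rule M_cases)
  show "\<sim>\<^bsub>?M\<^esub> (x \<squnion>\<^bsub>?M\<^esub> y) = (\<sim>\<^bsub>?M\<^esub> x) \<sqinter>\<^bsub>?M\<^esub> (\<sim>\<^bsub>?M\<^esub> y)"
    using ab de by (simp add: x(1) y(1) M_ops sim_square sim_join closed)
  \<comment> \<open>The left side lies below the center \<open>(\<bottom>, \<top>)\<close> and the right side above it.\<close>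
  show "x \<sqinter>\<^bsub>?M\<^esub> (\<sim>\<^bsub>?M\<^esub> x) \<sqsubseteq>\<^bsub>?M\<^esub> y \<squnion>\<^bsub>?M\<^esub> (\<sim>\<^bsub>?M\<^esub> y)"
    using ab de
    by (simp add: x(1) y(1) M_ops lat_le_def lozenge_meet_sim_le square_join_sim_le
        bot_meet lozenge_bot meet_top closed)
qed

lemma M_neg_eq:
  assumes "a \<in> carrier T" "\<diamond> a = a"
  shows "\<ominus>\<^bsub>M_algebra T\<^esub> (a, b) = (\<diamond> (\<sim> a), \<sim> a)"
  using assms by (simp add: M_neg neg_lozenge_fixed)

text \<open>In N1 and N5 both sides are values of the negation of \<open>M(T)\<close>, which depends only on the
  first component, so it suffices to compare the first components of its arguments.\<close>

lemma M_KAN_algebra: "KAN_algebra (M_algebra T)"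
proof (intro KAN_algebra.intro[OF M_kleene_algebra] KAN_algebra_axioms.intro)
  let ?M = "M_algebra T"
  fix x assume "x \<in> carrier ?M"
  then obtain a b where x: "x = (a, b)" "(a, b) \<in> carrier ?M"
    and ab: "a \<in> carrier T" "b \<in> carrier T" "\<diamond> a = a" "\<box> b = b" "a \<sqsubseteq> b"
    by (rule M_cases)
  have sim_a: "\<box> (\<sim> a) = \<sim> a" and sim_b: "\<diamond> (\<sim> b) = \<sim> b"
    using ab square_eq[of "\<sim> a"] sim_square[of b] by (simp_all add: sim_sim closed)
  show "\<ominus>\<^bsub>?M\<^esub> x \<in> carrier ?M"
    using ab sim_a by (simp add: x(1) M_neg_eq M_carrier_iff closed lozenge_lozenge lozenge_le)
  \<comment> \<open>Both first components are \<open>\<bottom>\<close>.\<close>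
  show "x \<sqinter>\<^bsub>?M\<^esub> (\<sim>\<^bsub>?M\<^esub> x) = x \<sqinter>\<^bsub>?M\<^esub> (\<ominus>\<^bsub>?M\<^esub> x)"
    using ab by (simp add: x(1) M_neg_eq M_meet M_sim lozenge_meet_sim_le lozenge_meet_right
        lozenge_meet_sim closed)
  have "(\<sim> b) \<sqinter> (\<sim> a) = \<sim> b"
    using sim_antimono[of a b] ab by (simp add: lat_le_def)
  thus "(\<sim>\<^bsub>?M\<^esub> x) \<sqsubseteq>\<^bsub>?M\<^esub> (\<ominus>\<^bsub>?M\<^esub> x)"
    using ab sim_b by (simp add: x(1) M_neg_eq M_meet M_sim lat_le_def lozenge_meet_right
        meet_idem closed)
  fix y assume "y \<in> carrier ?M"
  then obtain d e where y: "y = (d, e)" "(d, e) \<in> carrier ?M"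
    and de: "d \<in> carrier T" "e \<in> carrier T" "\<diamond> d = d" "\<box> e = e" "d \<sqsubseteq> e"
    by (rule M_cases)
  have "\<diamond> (a \<sqinter> \<diamond> (\<sim> (\<diamond> (a \<sqinter> d)))) = \<diamond> (a \<sqinter> \<ominus> (a \<sqinter> d))"
    using ab de by (simp add: lozenge_meet_right sim_lozenge closed)
  also have "\<dots> = \<diamond> (a \<sqinter> \<ominus> d)"
    using ab de by (simp add: lozenge_def N1)
  also have "\<dots> = \<diamond> (a \<sqinter> \<diamond> (\<sim> d))"
    using ab de by (simp add: neg_lozenge_fixed lozenge_meet_right closed)
  finally show "\<ominus>\<^bsub>?M\<^esub> (x \<sqinter>\<^bsub>?M\<^esub> (\<ominus>\<^bsub>?M\<^esub> (x \<sqinter>\<^bsub>?M\<^esub> y))) = \<ominus>\<^bsub>?M\<^esub> (x \<sqinter>\<^bsub>?M\<^esub> (\<ominus>\<^bsub>?M\<^esub> y))"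
    using ab de by (simp add: x(1) y(1) M_meet M_neg_eq lozenge_lozenge closed)
  show "\<ominus>\<^bsub>?M\<^esub> (x \<squnion>\<^bsub>?M\<^esub> y) = (\<ominus>\<^bsub>?M\<^esub> x) \<sqinter>\<^bsub>?M\<^esub> (\<ominus>\<^bsub>?M\<^esub> y)"
    using ab de by (simp add: x(1) y(1) M_meet M_join M_neg_eq lozenge_join sim_join
        lozenge_meet_left lozenge_meet_right closed)
  show "\<ominus>\<^bsub>?M\<^esub> (x \<sqinter>\<^bsub>?M\<^esub> y) = \<ominus>\<^bsub>?M\<^esub> ((\<sim>\<^bsub>?M\<^esub> (\<ominus>\<^bsub>?M\<^esub> x)) \<sqinter>\<^bsub>?M\<^esub> y)"
    using ab de by (simp add: x(1) y(1) M_meet M_sim M_neg_eq sim_sim lozenge_lozenge closed)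
qed

end

theorem theorem4p1:
  fixes T :: "('a, 'b) KAN_algebra_sig_scheme"
  assumes "KAN_algebra T"
  shows "centered_KAN_algebra (M_algebra T)"
proof -
  interpret KAN_algebra T by (rule assms)
  show ?thesis
  proof (intro centered_KAN_algebra.intro[OF M_KAN_algebra] centered_KAN_algebra_axioms.intro)
    show "\<c>\<^bsub>M_algebra T\<^esub> \<in> carrier (M_algebra T)"
      by (simp add: M_center M_carrier_iff closed lozenge_bot square_top bot_least)
    show "\<sim>\<^bsub>M_algebra T\<^esub> \<c>\<^bsub>M_algebra T\<^esub> = \<c>\<^bsub>M_algebra T\<^esub>"
      by (simp add: M_center M_sim sim_top sim_bot)
  qed
qed

end
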